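(* Let $G$ be a connected $d$-regular graph with $d\ge 3$ and edge connectivity $\kappa'$. Suppose that either $\kappa'=d$, or $\kappa'<d$ and \[ \lambda_{\left\lceil\frac{d}{d-\kappa'}\right\rceil}(G) < \begin{cases} \frac{d-2+\sqrt{d^2+12}}{2}, & \text{if } d \text{ is even},\\ \frac{d-2+\sqrt{d^2+8}}{2}, & \text{if } d \text{ is odd}.\end{cases} \] Then $t(G)\ge 1$.
   Context: All graphs are finite, undirected and simple. For a graph $G$ of order $n$, $\lambda_1(G)\ge\lambda_2(G)\ge\dots\ge\lambda_n(G)$ denote the eigenvalues of its adjacency matrix (with multiplicity). The edge connectivity of $G$ is denoted $\kappa'=\kappa'(G)$, and $c(H)$ denotes the number of components of a graph $H$. The toughness of a connected graph $G$ is $t(G)=\min\left\{\frac{|S|}{c(G-S)}\right\}$, where the minimum is taken over all proper subsets $S\subset V(G)$ such that $c(G-S)>1$; if no such $S$ exists (i.e. $G$ is complete), $t(G)=+\infty$, so that any lower bound on $t(G)$ holds. *)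

theory Defs
  imports
    "Graph_Theory.Digraph_Component"
    "Jordan_Normal_Form.Char_Poly"
    "HOL-Library.Extended_Real"
begin

text \<open>
  A finite simple undirected graph is a value satisfying \<open>Digraph.graph\<close>: a finite symmetric
  digraph without loops and parallel arcs, in which an undirected edge \<open>{u, v}\<close> appears as the two
  arcs \<open>(u, v)\<close> and \<open>(v, u)\<close>.  Undirected edges must therefore be counted as doubletons, not as arcs.
\<close>

definition graph_edges :: "('a, 'b) pre_digraph \<Rightarrow> 'a set set" where
  "graph_edges G = (\<lambda>e. {tail G e, head G e}) ` arcs G"

definition del_edges :: "('a, 'b) pre_digraph \<Rightarrow> 'a set set \<Rightarrow> ('a, 'b) pre_digraph" where
  "del_edges G F = G\<lparr>arcs := {e \<in> arcs G. {tail G e, head G e} \<notin> F}\<rparr>"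

text \<open>
  By symmetry the out-degree of a vertex is the number of its neighbours.
\<close>

definition regular_graph :: "('a, 'b) pre_digraph \<Rightarrow> nat \<Rightarrow> bool" where
  "regular_graph G d \<longleftrightarrow> (\<forall>v \<in> verts G. out_degree G v = d)"

text \<open>
  The one-vertex graph cannot be disconnected; it gets the value \<open>Inf {} = 0\<close>.
\<close>

definition edge_connectivity :: "('a, 'b) pre_digraph \<Rightarrow> nat" where
  "edge_connectivity G =
     Inf {card F | F. F \<subseteq> graph_edges G \<and> \<not> Digraph_Component.connected (del_edges G F)}"

definition graph_components :: "('a, 'b) pre_digraph \<Rightarrow> ('a, 'b) pre_digraph set" where
  "graph_components G = {H. pre_digraph.max_subgraph G Digraph_Component.connected H}"

text \<open>
  If no set \<open>S\<close> qualifies, that is, if \<open>G\<close> is complete, the infimum over the empty set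
  in \<^typ>\<open>ereal\<close> is \<open>\<infinity>\<close>; otherwise it is a minimum over finitely many values.
\<close>

definition toughness :: "('a, 'b) pre_digraph \<Rightarrow> ereal" where
  "toughness G =
     (INF S \<in> {S. S \<subset> verts G \<and> card (graph_components (G \<restriction> (verts G - S))) > 1}.
        ereal (real (card S) / real (card (graph_components (G \<restriction> (verts G - S))))))"

definition adjacency_matrix :: "('a, 'b) pre_digraph \<Rightarrow> 'a list \<Rightarrow> real mat" where
  "adjacency_matrix G vs =
     Matrix.mat (length vs) (length vs) (\<lambda>(i, j). if vs ! i \<rightarrow>\<^bsub>G\<^esub> vs ! j then 1 else 0)"

text \<open>
  The vertices are listed in an arbitrary order; another order conjugates the matrix by a
  permutation matrix and so leaves the characteristic polynomial unchanged.  Since the matrix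
  is real symmetric, all the roots of that polynomial are real and the list below has as many
  entries as \<open>G\<close> has vertices.
\<close>

definition eigenvalues :: "('a, 'b) pre_digraph \<Rightarrow> real list" where
  "eigenvalues G =
     rev (sorted_list_of_multiset (proots (char_poly
       (adjacency_matrix G (SOME vs. distinct vs \<and> set vs = verts G)))))"

text \<open>The eigenvalues are numbered from 1, in decreasing order.\<close>

definition eigenvalue_nth :: "('a, 'b) pre_digraph \<Rightarrow> nat \<Rightarrow> real" where
  "eigenvalue_nth G i = eigenvalues G ! (i - 1)"

end

theory Submission
  imports Defs
begin

text \<open>
  Suppose that removing \<open>S\<close> leaves more than \<open>|S|\<close> components.  Write \<open>e(C)\<close> for the number of edges
  between a component \<open>C\<close> and \<open>S\<close>.  Each \<open>e(C)\<close> is the size of an edge cut, hence at least \<open>\<kappa>\<close>, and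
  the \<open>e(C)\<close> sum to at most \<open>d |S|\<close>.  If \<open>\<kappa> = d\<close>, this is already a contradiction.  Otherwise let \<open>p\<close> be
  the number of components with \<open>e(C) < d\<close>; the count gives \<open>p (d - \<kappa>) \<ge> d\<close>, so \<open>p\<close> is at
  least the index \<open>\<lceil>d / (d - \<kappa>)\<rceil>\<close> of the eigenvalue in the hypothesis.

  A component with \<open>e(C) < d\<close> induces a subgraph that is nearly \<open>d\<close>-regular: its degrees
  miss \<open>d\<close> by \<open>e(C)\<close> in total.  That total is at most \<open>d - k\<close> with \<open>k = 1\<close>, and with \<open>k = 2\<close>
  when \<open>d\<close> is even, since then \<open>e(C)\<close> is even by the handshake lemma.  Such a subgraph has at least
  \<open>d + 1\<close> vertices.  With \<open>d + 2\<close> or more its average degree is large enough.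
  With exactly \<open>d + 1\<close> it contains \<open>k + 1\<close> vertices adjacent to all others, and a function with one value
  on these and another value on the rest has Rayleigh quotient at least the threshold \<open>t\<close>, which
  is the larger root of \<open>X\<^sup>2 - (d - 2) X - (d + k)\<close> (\<open>cluster_test_function\<close>).

  Distinct components have no edges between them, so these \<open>p\<close> functions span a \<open>p\<close>-dimensional space on which
  the adjacency form is at least \<open>t\<close> times the squared norm.  By the Courant-Fischer principle
  at least \<open>p\<close> eigenvalues are \<open>\<ge> t\<close> (\<open>courant_fischer_count\<close>), contrary to the
  hypothesis.  The principle rests on the spectral theorem, proved here by induction on the
  dimension: a Householder reflection moves a unit eigenvector to the first coordinate axis and thereby splits off a
  diagonal entry.
\<close>

section \<open>The spectral theorem for real symmetric matrices\<close>

text \<open>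
  Over the complex numbers an eigenvector exists by the fundamental theorem of algebra.
  It is split into real and imaginary parts to stay within real scalar products.
\<close>

lemma symmetric_mat_unit_eigenvector:
  fixes A :: "real mat"
  assumes A: "A \<in> carrier_mat n n" and sym: "A\<^sup>T = A" and n: "n > 0"
  obtains v l where "v \<in> carrier_vec n" "v \<bullet> v = 1" "A *\<^sub>v v = l \<cdot>\<^sub>v v"
proof -
  define C where "C = map_mat complex_of_real A"
  have C: "C \<in> carrier_mat n n"
    using A by (simp add: C_def)
  obtain as where as: "char_poly C = (\<Prod>a\<leftarrow>as. [:- a, 1:])" "length as = n"
    using char_poly_factorized[OF C] by blast
  obtain a where "a \<in> set as"
    using as(2) n by (cases as) auto
  hence "poly (char_poly C) a = 0"
    unfolding as(1) by (auto simp: poly_prod_list prod_list_zero_iff)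
  then obtain z where "eigenvector C z a"
    using eigenvalue_root_char_poly[OF C] unfolding eigenvalue_def by blast
  hence z: "z \<in> carrier_vec n" "z \<noteq> 0\<^sub>v n" "C *\<^sub>v z = a \<cdot>\<^sub>v z"
    using C by (auto simp: eigenvector_def)
  define x y where "x = map_vec Re z" and "y = map_vec Im z"
  have xy[simp]: "x \<in> carrier_vec n" "y \<in> carrier_vec n"
    using z(1) by (auto simp: x_def y_def)
  have dims[simp]: "dim_vec x = n" "dim_vec y = n"
    using z(1) by (auto simp: x_def y_def)
  have row: "(\<Sum>j<n. complex_of_real (A $$ (i,j)) * z $ j) = a * z $ i" if "i < n" for i
  proof -
    have "(C *\<^sub>v z) $ i = (\<Sum>j<n. complex_of_real (A $$ (i,j)) * z $ j)"
      using that A z(1) by (simp add: C_def scalar_prod_def atLeast0LessThan)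
    with z that show ?thesis by simp
  qed
  have Ax: "A *\<^sub>v x = Re a \<cdot>\<^sub>v x - Im a \<cdot>\<^sub>v y"
  proof (rule eq_vecI)
    fix i assume "i < dim_vec (Re a \<cdot>\<^sub>v x - Im a \<cdot>\<^sub>v y)"
    hence i: "i < n" using xy(2) by auto
    have "(A *\<^sub>v x) $ i = Re (\<Sum>j<n. complex_of_real (A $$ (i,j)) * z $ j)"
      using i A z(1) by (simp add: x_def scalar_prod_def atLeast0LessThan)
    also have "\<dots> = Re (a * z $ i)" using row i by simp
    finally show "(A *\<^sub>v x) $ i = (Re a \<cdot>\<^sub>v x - Im a \<cdot>\<^sub>v y) $ i"
      using i z(1) by (simp add: x_def y_def)
  qed (use A xy in auto)
  have Ay: "A *\<^sub>v y = Re a \<cdot>\<^sub>v y + Im a \<cdot>\<^sub>v x"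
  proof (rule eq_vecI)
    fix i assume "i < dim_vec (Re a \<cdot>\<^sub>v y + Im a \<cdot>\<^sub>v x)"
    hence i: "i < n" using xy(1) by auto
    have "(A *\<^sub>v y) $ i = Im (\<Sum>j<n. complex_of_real (A $$ (i,j)) * z $ j)"
      using i A z(1) by (simp add: y_def scalar_prod_def atLeast0LessThan)
    also have "\<dots> = Im (a * z $ i)" using row i by simp
    finally show "(A *\<^sub>v y) $ i = (Re a \<cdot>\<^sub>v y + Im a \<cdot>\<^sub>v x) $ i"
      using i z(1) by (simp add: x_def y_def)
  qed (use A xy in auto)
  have pos: "v \<bullet> v > 0" if "v \<in> carrier_vec n" "v \<noteq> 0\<^sub>v n" for v :: "real vec"
    using conjugate_square_greater_0_vec[OF that(1)] that(2) by simp
  have nonneg: "v \<bullet> v \<ge> 0" for v :: "real vec"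
    using conjugate_square_ge_0_vec[of v] by simp
  have some: "x \<noteq> 0\<^sub>v n \<or> y \<noteq> 0\<^sub>v n"
  proof (rule ccontr)
    assume "\<not> ?thesis"
    hence xy0: "x = 0\<^sub>v n" "y = 0\<^sub>v n" by auto
    have "z = 0\<^sub>v n"
    proof (rule eq_vecI)
      fix i assume "i < dim_vec (0\<^sub>v n :: complex vec)"
      hence i: "i < n" by simp
      have "Re (z $ i) = x $ i" "Im (z $ i) = y $ i"
        using i z(1) by (simp_all add: x_def y_def)
      thus "z $ i = 0\<^sub>v n $ i"
        using i by (simp add: xy0 complex_eq_iff)
    qed (use z(1) in auto)
    with z(2) show False by simp
  qed
  \<comment> \<open>Symmetry of the form \<open>(x, y) \<mapsto> y \<bullet> A x\<close> forces the imaginary part of the eigenvalue to vanish,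
      so both the real and the imaginary part of the eigenvector satisfy the eigenvalue equation.\<close>
  have "x \<bullet> (A *\<^sub>v y) = y \<bullet> (A *\<^sub>v x)"
    using transpose_vec_mult_scalar[OF A xy(2) xy(1)] sym
      comm_scalar_prod[OF xy(1) mult_mat_vec_carrier[OF A xy(2)]]
      comm_scalar_prod[OF mult_mat_vec_carrier[OF A xy(1)] xy(2)] by simp
  moreover have "x \<bullet> (A *\<^sub>v y) = Re a * (x \<bullet> y) + Im a * (x \<bullet> x)"
    unfolding Ay using xy scalar_prod_add_distrib[of x n "Re a \<cdot>\<^sub>v y" "Im a \<cdot>\<^sub>v x"] by simp
  moreover have "y \<bullet> (A *\<^sub>v x) = Re a * (x \<bullet> y) - Im a * (y \<bullet> y)"
    unfolding Ax using xy comm_scalar_prod[OF xy]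
      scalar_prod_minus_distrib[of y n "Re a \<cdot>\<^sub>v x" "Im a \<cdot>\<^sub>v y"] by simp
  ultimately have "Im a * (x \<bullet> x + y \<bullet> y) = 0"
    by (simp add: algebra_simps)
  moreover have "x \<bullet> x + y \<bullet> y > 0"
    using some pos[OF xy(1)] pos[OF xy(2)] nonneg[of x] nonneg[of y] by linarith
  ultimately have "Im a = 0" by simp
  hence eig: "A *\<^sub>v x = Re a \<cdot>\<^sub>v x" "A *\<^sub>v y = Re a \<cdot>\<^sub>v y"
    using Ax Ay xy by (auto intro!: eq_vecI)
  have "\<exists>u. u \<in> carrier_vec n \<and> u \<noteq> 0\<^sub>v n \<and> A *\<^sub>v u = Re a \<cdot>\<^sub>v u"
    using some eig xy by blast
  then obtain u where u: "u \<in> carrier_vec n" "u \<noteq> 0\<^sub>v n" "A *\<^sub>v u = Re a \<cdot>\<^sub>v u"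
    by blast
  define v where "v = (1 / sqrt (u \<bullet> u)) \<cdot>\<^sub>v u"
  show thesis
  proof (rule that)
    show "v \<in> carrier_vec n" using u(1) by (simp add: v_def)
    show "v \<bullet> v = 1"
      using u(1) pos[OF u(1,2)] by (simp add: v_def)
    show "A *\<^sub>v v = Re a \<cdot>\<^sub>v v"
      using A u(1,3) by (simp add: v_def mult_mat_vec smult_smult_assoc mult.commute)
  qed
qed

text \<open>
  The reflection in the hyperplane orthogonal to \<open>w = v - e\<^sub>0\<close> swaps \<open>v\<close> and the first unit
  vector \<open>e\<^sub>0\<close>, because the two have the same length.
\<close>

lemma reflection_with_first_column:
  fixes v :: "real vec"
  assumes v: "v \<in> carrier_vec n" and n: "n > 0" and unit: "v \<bullet> v = 1"
  obtains H where "H \<in> carrier_mat n n" "H\<^sup>T = H" "H * H = 1\<^sub>m n" "col H 0 = v"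
proof (cases "v = unit_vec n 0")
  case True
  show thesis by (rule that[of "1\<^sub>m n"]) (use True n in auto)
next
  case False
  define w where "w = v - unit_vec n 0"
  define s where "s = (\<Sum>k<n. (w $ k)\<^sup>2)"
  have wi: "w $ i = v $ i - (if i = 0 then 1 else 0)" if "i < n" for i
    using that v by (simp add: w_def unit_vec_def)
  have vv: "(\<Sum>k<n. (v $ k)\<^sup>2) = 1"
    using unit v by (simp add: scalar_prod_def atLeast0LessThan power2_eq_square)
  have "s = (\<Sum>k<n. (v $ k)\<^sup>2 + (if k = 0 then 1 - 2 * v $ k else 0))"
    unfolding s_def by (rule sum.cong) (auto simp: wi power2_eq_square algebra_simps)
  also have "\<dots> = 1 + (1 - 2 * v $ 0)"
    using n by (simp add: sum.distrib vv)
  finally have s_eq: "s = - 2 * w $ 0"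
    using wi[of 0] n by simp
  have "\<exists>k<n. w $ k \<noteq> 0"
  proof (rule ccontr)
    assume "\<not> ?thesis"
    hence "v = unit_vec n 0" using v wi by (intro eq_vecI) (auto simp: unit_vec_def)
    with False show False ..
  qed
  hence s0: "s > 0"
    unfolding s_def by (metis finite_lessThan lessThan_iff sum_pos2 zero_le_power2 zero_less_power2)
  define t where "t = 2 / s"
  have ts: "t * s = 2" using s0 by (simp add: t_def)
  define H where "H = mat n n (\<lambda>(i,j). (if i = j then 1 else 0) - t * w $ i * w $ j)"
  have HH: "(\<Sum>k<n. ((if i = k then 1 else 0) - t * w $ i * w $ k)
      * ((if k = j then 1 else 0) - t * w $ k * w $ j)) = (if i = j then 1 else 0)"
    if "i < n" "j < n" for i j
  proof -
    have "(\<Sum>k<n. ((if i = k then 1 else 0) - t * w $ i * w $ k)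
      * ((if k = j then 1 else 0) - t * w $ k * w $ j))
      = (\<Sum>k<n. (if i = k then (if i = j then 1 else 0) else 0)
          - (if i = k then t * w $ i * w $ j else 0)
          - (if k = j then t * w $ i * w $ j else 0)
          + t * t * w $ i * w $ j * (w $ k)\<^sup>2)"
      by (rule sum.cong) (auto simp: power2_eq_square algebra_simps)
    also have "\<dots> = (if i = j then 1 else 0) - 2 * t * w $ i * w $ j + t * t * w $ i * w $ j * s"
    proof -
      have "(\<Sum>k<n. t * t * w $ i * w $ j * (w $ k)\<^sup>2) = t * t * w $ i * w $ j * s"
        by (simp only: s_def sum_distrib_left)
      thus ?thesis
        by (simp only: sum.distrib sum_subtractf) (simp add: that)
    qed
    also have "t * t * w $ i * w $ j * s = (t * s) * (t * w $ i * w $ j)"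
      by (simp add: mult_ac)
    finally show ?thesis by (simp add: ts)
  qed
  show thesis
  proof (rule that)
    show "H \<in> carrier_mat n n" by (simp add: H_def)
    show "H\<^sup>T = H" by (rule eq_matI) (auto simp: H_def)
    show "H * H = 1\<^sub>m n"
      by (rule eq_matI) (auto simp: H_def scalar_prod_def atLeast0LessThan HH)
    show "col H 0 = v"
    proof (rule eq_vecI)
      fix i assume "i < dim_vec v"
      hence i: "i < n" using v by simp
      have "t * w $ 0 = -1" using ts s_eq by (simp add: algebra_simps)
      hence "t * w $ i * w $ 0 = - w $ i" by (metis mult.commute mult.assoc mult_minus1_right)
      thus "col H 0 $ i = v $ i"
        using i n wi[OF i] by (simp add: H_def)
    qed (use v in \<open>simp add: H_def\<close>)
  qed
qed

theorem spectral_theorem_real_symmetric: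
  fixes A :: "real mat"
  assumes "A \<in> carrier_mat n n" and "A\<^sup>T = A"
  shows "\<exists>U e. U \<in> carrier_mat n n \<and> U\<^sup>T * U = 1\<^sub>m n \<and> U\<^sup>T * A * U = mat_diag n e"
  using assms
proof (induction n arbitrary: A)
  case 0
  have "(1\<^sub>m 0 :: real mat) \<in> carrier_mat 0 0 \<and> (1\<^sub>m 0)\<^sup>T * 1\<^sub>m 0 = (1\<^sub>m 0 :: real mat)
    \<and> (1\<^sub>m 0)\<^sup>T * A * 1\<^sub>m 0 = mat_diag 0 (\<lambda>_. 0)"
    using 0 by (auto simp: mat_diag_def)
  thus ?case by blast
next
  case (Suc m)
  note A = Suc.prems(1)
  obtain v l where v: "v \<in> carrier_vec (Suc m)" "v \<bullet> v = 1" "A *\<^sub>v v = l \<cdot>\<^sub>v v"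
    using symmetric_mat_unit_eigenvector[OF A Suc.prems(2)] by blast
  obtain H where H: "H \<in> carrier_mat (Suc m) (Suc m)" "H\<^sup>T = H" "H * H = 1\<^sub>m (Suc m)" "col H 0 = v"
    using reflection_with_first_column[OF v(1) _ v(2)] by blast
  \<comment> \<open>Since \<open>H\<close> maps \<open>v\<close> to the first unit vector, the first column of \<open>H A H\<close> is zero off the diagonal,
      and by symmetry so is its first row.\<close>
  define B where "B = H * A * H"
  have B: "B \<in> carrier_mat (Suc m) (Suc m)" using A H by (simp add: B_def)
  have Bsym: "B\<^sup>T = B"
    unfolding B_def using A H Suc.prems(2)
    by (simp add: transpose_mult[of _ "Suc m" "Suc m" _ "Suc m"] assoc_mult_mat[of _ "Suc m" "Suc m" _ "Suc m" _ "Suc m"])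
  have Hv: "H *\<^sub>v v = unit_vec (Suc m) 0"
  proof -
    have "H *\<^sub>v col H 0 = col (H * H) 0" using col_mult2[OF H(1) H(1), of 0] by simp
    thus ?thesis using H(3,4) by simp
  qed
  have "col B 0 = (H * A) *\<^sub>v v"
    unfolding B_def using col_mult2[of "H * A" "Suc m" "Suc m" H "Suc m" 0] A H by simp
  also have "\<dots> = l \<cdot>\<^sub>v unit_vec (Suc m) 0"
    using assoc_mult_mat_vec[OF H(1) A v(1)] mult_mat_vec[OF H(1) v(1)] v(3) Hv by simp
  finally have colB: "col B 0 = l \<cdot>\<^sub>v unit_vec (Suc m) 0" .
  have B0: "B $$ (i, 0) = (if i = 0 then l else 0)" if "i < Suc m" for i
    using arg_cong[OF colB, of "\<lambda>u. u $ i"] that B by (simp add: unit_vec_def)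
  have B0': "B $$ (0, i) = (if i = 0 then l else 0)" if "i < Suc m" for i
    using B0[OF that] that Bsym B by (metis carrier_matD index_transpose_mat(1) zero_less_Suc)
  define A' where "A' = mat m m (\<lambda>(i,j). B $$ (Suc i, Suc j))"
  have A': "A' \<in> carrier_mat m m" by (simp add: A'_def)
  have "A'\<^sup>T = A'"
  proof (rule eq_matI)
    fix i j assume "i < dim_row A'" "j < dim_col A'"
    hence "i < m" "j < m" by (auto simp: A'_def)
    moreover have "B $$ (Suc j, Suc i) = B $$ (Suc i, Suc j)" if "i < m" "j < m"
      using Bsym B that by (metis Suc_less_eq carrier_matD index_transpose_mat(1))
    ultimately show "A'\<^sup>T $$ (i, j) = A' $$ (i, j)" by (simp add: A'_def)
  qed (auto simp: A'_def)
  with Suc.IH[OF A'] obtain U e where U: "U \<in> carrier_mat m m" "U\<^sup>T * U = 1\<^sub>m m"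
    "U\<^sup>T * A' * U = mat_diag m e" by blast
  define L where "L = mat 1 1 (\<lambda>_. l)"
  define K where "K = four_block_mat (1\<^sub>m 1) (0\<^sub>m 1 m) (0\<^sub>m m 1) U"
  have L: "L \<in> carrier_mat 1 1" by (simp add: L_def)
  have K: "K \<in> carrier_mat (Suc m) (Suc m)" using U(1) four_block_carrier_mat[of "1\<^sub>m 1" 1 1 U m m] by (simp add: K_def)
  have KT: "K\<^sup>T = four_block_mat (1\<^sub>m 1) (0\<^sub>m 1 m) (0\<^sub>m m 1) (U\<^sup>T)"
    unfolding K_def by (subst transpose_four_block_mat[of _ 1 1 _ m _ m]) (use U in auto)
  have Bblock: "B = four_block_mat L (0\<^sub>m 1 m) (0\<^sub>m m 1) A'"
    by (rule eq_matI) (use B in \<open>auto simp: L_def A'_def B0 B0'\<close>)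
  have KK: "K\<^sup>T * K = 1\<^sub>m (Suc m)"
    unfolding KT unfolding K_def
    by (subst mult_four_block_mat[of _ 1 1 _ m _ m _ _ 1 _ m]) (use U in auto)
  have "K\<^sup>T * B = four_block_mat L (0\<^sub>m 1 m) (0\<^sub>m m 1) (U\<^sup>T * A')"
    unfolding KT unfolding Bblock
    by (subst mult_four_block_mat[of _ 1 1 _ m _ m _ _ 1 _ m]) (use U L A' in auto)
  hence "K\<^sup>T * B * K = four_block_mat L (0\<^sub>m 1 m) (0\<^sub>m m 1) (mat_diag m e)"
    unfolding K_def U(3)[symmetric]
    by (simp, subst mult_four_block_mat[of _ 1 1 _ m _ m _ _ 1 _ m]) (use U L A' in auto)
  also have "\<dots> = mat_diag (Suc m) (case_nat l e)"
    by (rule eq_matI) (auto simp: L_def mat_diag_def split: nat.splits)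
  finally have KBK: "K\<^sup>T * B * K = mat_diag (Suc m) (case_nat l e)" .
  have "(H * K)\<^sup>T * (H * K) = K\<^sup>T * ((H * H) * K)"
    using H(1,2) K by (simp add: transpose_mult[of _ "Suc m" "Suc m" _ "Suc m"]
        assoc_mult_mat[of _ "Suc m" "Suc m" _ "Suc m" _ "Suc m"])
  also have "\<dots> = 1\<^sub>m (Suc m)" using H(3) K KK by simp
  finally have "(H * K)\<^sup>T * (H * K) = 1\<^sub>m (Suc m)" .
  moreover have "(H * K)\<^sup>T * A * (H * K) = K\<^sup>T * B * K"
    using H(1,2) K A by (simp add: B_def transpose_mult[of _ "Suc m" "Suc m" _ "Suc m"]
        assoc_mult_mat[of _ "Suc m" "Suc m" _ "Suc m" _ "Suc m"])
  moreover have "H * K \<in> carrier_mat (Suc m) (Suc m)" using H K by simp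
  ultimately show ?case using KBK by metis
qed

section \<open>Lower bounds for the eigenvalues in decreasing order\<close>

text \<open>
  The equations indexed by \<open>J\<close> are fewer than the unknowns, so padding them with zero rows gives a
  square matrix that is singular: its transpose kills a unit vector.
\<close>

lemma underdetermined_system_nontrivial_solution:
  fixes M :: "'a :: field mat"
  assumes M: "M \<in> carrier_mat n q" and J: "J \<subseteq> {..<n}" "card J < q"
  obtains c where "c \<in> carrier_vec q" "c \<noteq> 0\<^sub>v q" "\<And>i. i \<in> J \<Longrightarrow> (M *\<^sub>v c) $ i = 0"
proof -
  have finJ: "finite J" using J(1) finite_subset by blast
  obtain g where g: "bij_betw g {0..<card J} J"
    using ex_bij_betw_nat_finite[OF finJ] by blast
  define N where "N = mat q q (\<lambda>(r,k). if r < card J then M $$ (g r, k) else 0)"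
  have N: "N \<in> carrier_mat q q" by (simp add: N_def)
  have "N\<^sup>T *\<^sub>v unit_vec q (card J) = 0\<^sub>v q"
    using J(2) by (auto simp: N_def scalar_prod_right_unit intro!: eq_vecI)
  moreover have "unit_vec q (card J) \<noteq> (0\<^sub>v q :: 'a vec)"
    using J(2) by simp
  ultimately have "det N\<^sup>T = 0"
    using det_0_iff_vec_prod_zero_field[of "N\<^sup>T" q] N
    by (meson transpose_carrier_mat unit_vec_carrier)
  hence "det N = 0" using det_transpose[OF N] by simp
  then obtain c where c: "c \<in> carrier_vec q" "c \<noteq> 0\<^sub>v q" "N *\<^sub>v c = 0\<^sub>v q"
    using det_0_iff_vec_prod_zero_field[OF N] by auto
  show thesis
  proof (rule that[OF c(1,2)])
    fix i assume "i \<in> J"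
    hence "i \<in> g ` {0..<card J}" using g by (simp add: bij_betw_def)
    then obtain r where r: "r < card J" "g r = i" by auto
    have i: "i < n" using \<open>i \<in> J\<close> J(1) by auto
    have "row N r = row M i"
      using r J(2) M i by (auto simp: N_def intro!: eq_vecI)
    hence "(M *\<^sub>v c) $ i = (N *\<^sub>v c) $ r"
      using r J(2) N M i by simp
    thus "(M *\<^sub>v c) $ i = 0" using c(3) r J(2) by simp
  qed
qed

lemma nth_of_decreasing_list_ge:
  fixes xs :: "'a :: linorder list"
  assumes "sorted (rev xs)" and "1 \<le> q" and q: "q \<le> length (filter (\<lambda>x. t \<le> x) xs)"
  shows "t \<le> xs ! (q - 1)"
proof (rule ccontr)
  assume "\<not> t \<le> xs ! (q - 1)"
  hence less: "xs ! (q - 1) < t" by simp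
  have "q \<le> length xs"
    using q length_filter_le le_trans by blast
  have "filter (\<lambda>x. t \<le> x) (drop (q - 1) xs) = []"
  proof -
    have "xs ! j < t" if "q - 1 \<le> j" "j < length xs" for j
      using sorted_rev_nth_mono[OF assms(1) that] less by simp
    thus ?thesis
      by (auto simp: filter_empty_conv in_set_conv_nth not_le)
  qed
  hence "filter (\<lambda>x. t \<le> x) xs = filter (\<lambda>x. t \<le> x) (take (q - 1) xs)"
    by (metis append_take_drop_id filter_append append_Nil2)
  hence "length (filter (\<lambda>x. t \<le> x) xs) \<le> q - 1"
    by (metis length_filter_le length_take min.cobounded2 le_trans)
  with q \<open>1 \<le> q\<close> show False by simp
qed

lemma proots_prod_list_linear:
  "proots (\<Prod>a\<leftarrow>as. [:- a, 1:]) = mset (as :: 'a :: idom list)"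
proof (induction as)
  case (Cons a as)
  have "(\<Prod>a\<leftarrow>as. [:- a, 1:]) \<noteq> 0"
    by (auto simp: prod_list_zero_iff)
  thus ?case using Cons by (simp add: proots_mult del: mult_pCons_left)
qed simp

lemma mat_diag_mult_vec:
  fixes y :: "'a :: comm_semiring_0 vec"
  assumes "y \<in> carrier_vec n"
  shows "mat_diag n e *\<^sub>v y = vec n (\<lambda>i. e i * y $ i)"
proof (rule eq_vecI)
  fix i assume "i < dim_vec (vec n (\<lambda>i. e i * y $ i))"
  hence i: "i < n" by simp
  have "(mat_diag n e *\<^sub>v y) $ i = (\<Sum>j<n. (if i = j then e j else 0) * y $ j)"
    using i assms by (simp add: mat_diag_def scalar_prod_def atLeast0LessThan)
  also have "\<dots> = (\<Sum>j<n. if i = j then e j * y $ j else 0)"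
    by (rule sum.cong) auto
  also have "\<dots> = e i * y $ i" using i by simp
  finally show "(mat_diag n e *\<^sub>v y) $ i = vec n (\<lambda>i. e i * y $ i) $ i" using i by simp
qed (simp add: mat_diag_def)

text \<open>
  Let \<open>J\<close> index the eigenvalues that are at least \<open>t\<close>.  If \<open>J\<close> had fewer than \<open>q\<close> elements, some nonzero
  vector in the column space of \<open>F\<close> would be orthogonal to all eigenvectors indexed by \<open>J\<close>; it would
  be a combination of eigenvectors with eigenvalues below \<open>t\<close>, and its Rayleigh quotient would be below \<open>t\<close>.
\<close>

theorem courant_fischer_count:
  fixes A F :: "real mat"
  assumes A: "A \<in> carrier_mat n n" and sym: "A\<^sup>T = A" and F: "F \<in> carrier_mat n q"
    and inj: "\<And>c. c \<in> carrier_vec q \<Longrightarrow> c \<noteq> 0\<^sub>v q \<Longrightarrow> F *\<^sub>v c \<noteq> 0\<^sub>v n"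
    and form: "\<And>c. c \<in> carrier_vec q \<Longrightarrow>
      t * ((F *\<^sub>v c) \<bullet> (F *\<^sub>v c)) \<le> (F *\<^sub>v c) \<bullet> (A *\<^sub>v (F *\<^sub>v c))"
  shows "q \<le> size (filter_mset (\<lambda>x. t \<le> x) (proots (char_poly A)))"
proof -
  obtain U e where U: "U \<in> carrier_mat n n" "U\<^sup>T * U = 1\<^sub>m n" "U\<^sup>T * A * U = mat_diag n e"
    using spectral_theorem_real_symmetric[OF A sym] by blast
  have UT: "U\<^sup>T \<in> carrier_mat n n" using U by simp
  have UU: "U * U\<^sup>T = 1\<^sub>m n" using mat_mult_left_right_inverse[OF UT U(1) U(2)] .
  define D where "D = mat_diag n e"
  have D: "D \<in> carrier_mat n n" by (simp add: D_def)
  have AD: "A = U * D * U\<^sup>T"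
  proof -
    have "U * D * U\<^sup>T = (U * U\<^sup>T) * A * (U * U\<^sup>T)"
      unfolding D_def U(3)[symmetric] using A U(1)
      by (simp add: assoc_mult_mat[of _ n n _ n _ n])
    thus ?thesis using UU A by simp
  qed
  have "similar_mat_wit A D U U\<^sup>T"
    using A D U UU AD unfolding similar_mat_wit_def by (auto simp: Let_def)
  hence "char_poly A = char_poly D"
    by (intro char_poly_similar) (auto simp: similar_mat_def)
  also have "\<dots> = (\<Prod>a\<leftarrow>diag_mat D. [:- a, 1:])"
    by (rule char_poly_upper_triangular[OF D]) (auto simp: D_def mat_diag_def upper_triangular_def)
  also have "diag_mat D = map e [0..<n]"
    by (auto simp: diag_mat_def D_def mat_diag_def)
  finally have roots: "proots (char_poly A) = mset (map e [0..<n])"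
    using proots_prod_list_linear by metis
  define J where "J = {i. i < n \<and> t \<le> e i}"
  have "size (filter_mset (\<lambda>x. t \<le> x) (proots (char_poly A))) = length (filter (\<lambda>x. t \<le> x) (map e [0..<n]))"
    unfolding roots by (metis mset_filter size_mset)
  also have "\<dots> = card J"
    unfolding length_filter_conv_card J_def by (rule arg_cong[of _ _ card]) auto
  finally have size: "size (filter_mset (\<lambda>x. t \<le> x) (proots (char_poly A))) = card J" .
  show ?thesis
  proof (rule ccontr)
    assume "\<not> ?thesis"
    hence J: "card J < q" by (simp add: size)
    obtain c where c: "c \<in> carrier_vec q" "c \<noteq> 0\<^sub>v q"
      and cJ: "\<And>i. i \<in> J \<Longrightarrow> ((U\<^sup>T * F) *\<^sub>v c) $ i = 0"
      using underdetermined_system_nontrivial_solution[of "U\<^sup>T * F" n q J] UT F J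
      by (auto simp: J_def)
    \<comment> \<open>\<open>y\<close> lists the coordinates of \<open>x\<close> in the eigenvector basis.\<close>
    define x where "x = F *\<^sub>v c"
    define y where "y = U\<^sup>T *\<^sub>v x"
    have x: "x \<in> carrier_vec n" and y: "y \<in> carrier_vec n"
      using F UT c(1) by (auto simp: x_def y_def)
    have yJ: "y $ i = 0" if "i \<in> J" for i
      using cJ[OF that] UT F c(1) unfolding y_def x_def by (simp add: assoc_mult_mat_vec[of _ n n])
    have Uy: "U *\<^sub>v y = x"
      unfolding y_def using assoc_mult_mat_vec[OF U(1) UT x] UU x by simp
    have Ax: "A *\<^sub>v x = U *\<^sub>v (D *\<^sub>v y)"
      unfolding AD y_def using U(1) UT D x by (simp add: assoc_mult_mat_vec[of _ n n _ n])
    have xx: "x \<bullet> x = y \<bullet> y"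
      using transpose_vec_mult_scalar[OF U(1) y x] Uy by (simp add: y_def)
    have "x \<bullet> (A *\<^sub>v x) = y \<bullet> (D *\<^sub>v y)"
      using transpose_vec_mult_scalar[OF U(1) mult_mat_vec_carrier[OF D y] x]
      by (simp add: y_def Ax)
    also have "\<dots> = (\<Sum>i<n. e i * (y $ i)\<^sup>2)"
      unfolding D_def mat_diag_mult_vec[OF y]
      by (simp add: scalar_prod_def atLeast0LessThan power2_eq_square mult_ac)
    finally have xAx: "x \<bullet> (A *\<^sub>v x) = (\<Sum>i<n. e i * (y $ i)\<^sup>2)" .
    have yy: "y \<bullet> y = (\<Sum>i<n. (y $ i)\<^sup>2)"
      using y by (simp add: scalar_prod_def atLeast0LessThan power2_eq_square)
    have "U *\<^sub>v 0\<^sub>v n = 0\<^sub>v n"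
      using U(1) by (intro eq_vecI) auto
    hence "y \<noteq> 0\<^sub>v n"
      using inj[OF c] Uy by (auto simp: x_def)
    hence "\<exists>i<n. y $ i \<noteq> 0"
      using y by (metis carrier_vecD eq_vecI index_zero_vec)
    then obtain i where i: "i < n" "y $ i \<noteq> 0" by blast
    have "\<not> t \<le> e i" using i yJ[of i] by (auto simp: J_def)
    hence "e i < t" by simp
    have "0 < (\<Sum>i<n. (t - e i) * (y $ i)\<^sup>2)"
    proof (rule sum_pos2[of _ i])
      show "0 < (t - e i) * (y $ i)\<^sup>2" using i \<open>e i < t\<close> by simp
      show "0 \<le> (t - e j) * (y $ j)\<^sup>2" if "j \<in> {..<n}" for j
        using that yJ[of j] by (cases "t \<le> e j") (auto simp: J_def)
    qed (use i in auto)
    also have "\<dots> = t * (x \<bullet> x) - x \<bullet> (A *\<^sub>v x)"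
      unfolding xx xAx yy by (simp add: sum_distrib_left sum_subtractf algebra_simps)
    finally show False using form[OF c(1)] by (simp add: x_def)
  qed
qed

text \<open>
  Stated for an arbitrary weight \<open>w\<close> so that it covers both forms of the Rayleigh quotient: the
  squared norm (\<open>w\<close> the identity matrix) and the adjacency form (\<open>w\<close> the adjacency matrix).
\<close>

lemma decoupled_quadratic_form:
  fixes w :: "'a \<Rightarrow> 'a \<Rightarrow> real" and f :: "nat \<Rightarrow> 'a \<Rightarrow> real"
  assumes "\<And>j k u v. j < q \<Longrightarrow> k < q \<Longrightarrow> j \<noteq> k \<Longrightarrow> u \<in> V \<Longrightarrow> v \<in> V \<Longrightarrow> w u v * f j u * f k v = 0"
  shows "(\<Sum>u\<in>V. \<Sum>v\<in>V. w u v * (\<Sum>k<q. c k * f k u) * (\<Sum>k<q. c k * f k v))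
    = (\<Sum>k<q. (c k)\<^sup>2 * (\<Sum>u\<in>V. \<Sum>v\<in>V. w u v * f k u * f k v))"
proof -
  have "w u v * (\<Sum>k<q. c k * f k u) * (\<Sum>k<q. c k * f k v)
      = (\<Sum>k<q. (c k)\<^sup>2 * (w u v * f k u * f k v))" if "u \<in> V" "v \<in> V" for u v
  proof -
    have "w u v * (\<Sum>k<q. c k * f k u) * (\<Sum>k<q. c k * f k v)
      = (\<Sum>j<q. \<Sum>k<q. c j * c k * (w u v * f j u * f k v))"
      by (simp add: sum_product sum_distrib_left mult_ac)
    also have "\<dots> = (\<Sum>j<q. \<Sum>k<q. if j = k then (c k)\<^sup>2 * (w u v * f k u * f k v) else 0)"
      by (intro sum.cong refl) (use assms that in \<open>auto simp: power2_eq_square\<close>)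
    also have "\<dots> = (\<Sum>k<q. (c k)\<^sup>2 * (w u v * f k u * f k v))"
      by (rule sum.cong) auto
    finally show ?thesis .
  qed
  hence "(\<Sum>u\<in>V. \<Sum>v\<in>V. w u v * (\<Sum>k<q. c k * f k u) * (\<Sum>k<q. c k * f k v))
    = (\<Sum>u\<in>V. \<Sum>v\<in>V. \<Sum>k<q. (c k)\<^sup>2 * (w u v * f k u * f k v))"
    by simp
  also have "\<dots> = (\<Sum>u\<in>V. \<Sum>k<q. \<Sum>v\<in>V. (c k)\<^sup>2 * (w u v * f k u * f k v))"
    by (intro sum.cong refl sum.swap)
  also have "\<dots> = (\<Sum>k<q. \<Sum>u\<in>V. \<Sum>v\<in>V. (c k)\<^sup>2 * (w u v * f k u * f k v))"
    by (rule sum.swap)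
  finally show ?thesis by (simp add: sum_distrib_left)
qed

text \<open>
  The functions serve as columns of the matrix \<open>F\<close> in \<open>courant_fischer_count\<close>.  Both quadratic forms
  are diagonal in the coefficients of a linear combination, so a bound for each function is
  a bound for their whole span.
\<close>

theorem eigenvalue_nth_ge_of_decoupled_functions:
  fixes G :: "('a, 'b) pre_digraph" and f :: "nat \<Rightarrow> 'a \<Rightarrow> real"
  assumes G: "graph G" and q: "1 \<le> q"
    and nonzero: "\<And>k. k < q \<Longrightarrow> \<exists>v\<in>verts G. f k v \<noteq> 0"
    and disjoint: "\<And>j k v. j < q \<Longrightarrow> k < q \<Longrightarrow> j \<noteq> k \<Longrightarrow> f j v = 0 \<or> f k v = 0"
    and nonadjacent: "\<And>j k u v. j < q \<Longrightarrow> k < q \<Longrightarrow> j \<noteq> k \<Longrightarrow> u \<rightarrow>\<^bsub>G\<^esub> v \<Longrightarrow> f j u = 0 \<or> f k v = 0"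
    and form: "\<And>k. k < q \<Longrightarrow> t * (\<Sum>v\<in>verts G. (f k v)\<^sup>2)
      \<le> (\<Sum>u\<in>verts G. \<Sum>v\<in>verts G. of_bool (u \<rightarrow>\<^bsub>G\<^esub> v) * f k u * f k v)"
  shows "t \<le> eigenvalue_nth G q"
proof -
  interpret graph G by (rule G)
  define vs where "vs = (SOME vs. distinct vs \<and> set vs = verts G)"
  have "distinct vs \<and> set vs = verts G"
    unfolding vs_def by (rule someI_ex) (metis finite_distinct_list finite_verts)
  hence vs: "distinct vs" "set vs = verts G" by auto
  define n where "n = length vs"
  define A where "A = adjacency_matrix G vs"
  have A: "A \<in> carrier_mat n n" by (simp add: A_def adjacency_matrix_def n_def)
  have A_nth: "A $$ (i, j) = of_bool (vs ! i \<rightarrow>\<^bsub>G\<^esub> vs ! j)" if "i < n" "j < n" for i j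
    using that by (simp add: A_def adjacency_matrix_def n_def)
  have "A\<^sup>T = A"
    by (rule eq_matI) (use A A_nth graph_symmetric in auto)
  have sum_vs: "(\<Sum>i<n. h (vs ! i)) = sum h (verts G)" for h :: "'a \<Rightarrow> real"
    using vs sum.reindex_bij_betw[OF bij_betw_nth[OF vs(1), of "{..<n}" "verts G"]]
    by (simp add: n_def)
  define F where "F = mat n q (\<lambda>(i,k). f k (vs ! i))"
  have F: "F \<in> carrier_mat n q" by (simp add: F_def)
  define g where "g c v = (\<Sum>k<q. c $ k * f k v)" for c :: "real vec" and v
  have Fc: "F *\<^sub>v c = vec n (\<lambda>i. g c (vs ! i))" if "c \<in> carrier_vec q" for c
    using that by (auto simp: F_def g_def scalar_prod_def atLeast0LessThan mult.commute intro!: eq_vecI)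
  have norm: "(F *\<^sub>v c) \<bullet> (F *\<^sub>v c) = (\<Sum>k<q. (c $ k)\<^sup>2 * (\<Sum>v\<in>verts G. (f k v)\<^sup>2))"
    if c: "c \<in> carrier_vec q" for c
  proof -
    have diag: "(\<Sum>v\<in>verts G. of_bool (u = v) * x * h v) = x * h u" if "u \<in> verts G"
      for u x and h :: "'a \<Rightarrow> real"
    proof -
      have "(\<Sum>v\<in>verts G. of_bool (u = v) * x * h v) = (\<Sum>v\<in>verts G. if u = v then x * h v else 0)"
        by (rule sum.cong) auto
      thus ?thesis using that by simp
    qed
    have "(F *\<^sub>v c) \<bullet> (F *\<^sub>v c) = (\<Sum>u\<in>verts G. g c u * g c u)"
      unfolding Fc[OF c] sum_vs[symmetric] by (simp add: scalar_prod_def atLeast0LessThan)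
    also have "\<dots> = (\<Sum>u\<in>verts G. \<Sum>v\<in>verts G. of_bool (u = v) * g c u * g c v)"
      by (intro sum.cong refl) (simp add: diag)
    also have "\<dots> = (\<Sum>k<q. (c $ k)\<^sup>2 * (\<Sum>u\<in>verts G. \<Sum>v\<in>verts G. of_bool (u = v) * f k u * f k v))"
      unfolding g_def by (rule decoupled_quadratic_form) (use disjoint in auto)
    also have "\<dots> = (\<Sum>k<q. (c $ k)\<^sup>2 * (\<Sum>v\<in>verts G. (f k v)\<^sup>2))"
      by (intro sum.cong refl arg_cong2[of _ _ _ _ "(*)"]) (simp add: diag power2_eq_square)
    finally show ?thesis .
  qed
  have quad: "(F *\<^sub>v c) \<bullet> (A *\<^sub>v (F *\<^sub>v c)) = (\<Sum>k<q. (c $ k)\<^sup>2 *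
      (\<Sum>u\<in>verts G. \<Sum>v\<in>verts G. of_bool (u \<rightarrow>\<^bsub>G\<^esub> v) * f k u * f k v))"
    if c: "c \<in> carrier_vec q" for c
  proof -
    have "(F *\<^sub>v c) \<bullet> (A *\<^sub>v (F *\<^sub>v c))
      = (\<Sum>i<n. g c (vs ! i) * (\<Sum>j<n. of_bool (vs ! i \<rightarrow>\<^bsub>G\<^esub> vs ! j) * g c (vs ! j)))"
      unfolding Fc[OF c] using A by (simp add: scalar_prod_def atLeast0LessThan A_nth)
    also have "\<dots> = (\<Sum>u\<in>verts G. g c u * (\<Sum>v\<in>verts G. of_bool (u \<rightarrow>\<^bsub>G\<^esub> v) * g c v))"
      using sum_vs[of "\<lambda>v. of_bool (_ \<rightarrow>\<^bsub>G\<^esub> v) * g c v"]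
        sum_vs[of "\<lambda>u. g c u * (\<Sum>v\<in>verts G. of_bool (u \<rightarrow>\<^bsub>G\<^esub> v) * g c v)"] by simp
    also have "\<dots> = (\<Sum>u\<in>verts G. \<Sum>v\<in>verts G. of_bool (u \<rightarrow>\<^bsub>G\<^esub> v) * g c u * g c v)"
      unfolding sum_distrib_left by (intro sum.cong refl) (simp add: mult_ac)
    also have "\<dots> = (\<Sum>k<q. (c $ k)\<^sup>2 *
      (\<Sum>u\<in>verts G. \<Sum>v\<in>verts G. of_bool (u \<rightarrow>\<^bsub>G\<^esub> v) * f k u * f k v))"
      unfolding g_def by (rule decoupled_quadratic_form) (use nonadjacent in auto)
    finally show ?thesis .
  qed
  have "q \<le> size (filter_mset (\<lambda>x. t \<le> x) (proots (char_poly A)))"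
  proof (rule courant_fischer_count[OF A \<open>A\<^sup>T = A\<close> F])
    fix c :: "real vec" assume c: "c \<in> carrier_vec q"
    show "t * ((F *\<^sub>v c) \<bullet> (F *\<^sub>v c)) \<le> (F *\<^sub>v c) \<bullet> (A *\<^sub>v (F *\<^sub>v c))"
      unfolding norm[OF c] quad[OF c] sum_distrib_left[of t]
    proof (rule sum_mono)
      fix k assume "k \<in> {..<q}"
      thus "t * ((c $ k)\<^sup>2 * (\<Sum>v\<in>verts G. (f k v)\<^sup>2)) \<le> (c $ k)\<^sup>2 *
        (\<Sum>u\<in>verts G. \<Sum>v\<in>verts G. of_bool (u \<rightarrow>\<^bsub>G\<^esub> v) * f k u * f k v)"
        using mult_left_mono[OF form, of k "(c $ k)\<^sup>2"] by (simp add: mult_ac)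
    qed
    assume "c \<noteq> 0\<^sub>v q"
    hence "\<exists>k<q. c $ k \<noteq> 0"
      using c by (metis carrier_vecD eq_vecI index_zero_vec)
    then obtain k where k: "k < q" "c $ k \<noteq> 0" by blast
    obtain v where v: "v \<in> verts G" "f k v \<noteq> 0" using nonzero[OF k(1)] by blast
    have "0 < (\<Sum>v\<in>verts G. (f k v)\<^sup>2)"
      by (rule sum_pos2[OF _ v(1)]) (use v in auto)
    hence "0 < (\<Sum>k<q. (c $ k)\<^sup>2 * (\<Sum>v\<in>verts G. (f k v)\<^sup>2))"
      by (intro sum_pos2[of _ k]) (use k in \<open>auto intro!: mult_nonneg_nonneg sum_nonneg\<close>)
    thus "F *\<^sub>v c \<noteq> 0\<^sub>v n"
      unfolding norm[OF c, symmetric] by auto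
  qed
  also have "\<dots> = length (filter (\<lambda>x. t \<le> x) (eigenvalues G))"
    unfolding eigenvalues_def vs_def[symmetric] A_def[symmetric]
    by (metis mset_filter mset_rev mset_sorted_list_of_multiset size_mset)
  finally show ?thesis
    unfolding eigenvalue_nth_def
    by (intro nth_of_decreasing_list_ge q) (simp_all add: eigenvalues_def)
qed

section \<open>Nearly regular clusters\<close>

text \<open>
  The vertices of \<open>C\<close> miss degree \<open>d\<close> by at most \<open>d - k\<close> in total, which is impossible for
  \<open>|C| \<le> d\<close>.  For \<open>|C| \<ge> d + 2\<close> the constant function works, its Rayleigh quotient being the average
  degree.  For \<open>|C| = d + 1\<close> at least \<open>k + 1\<close> vertices are adjacent to all others.  The extremal graph
  consists of \<open>k + 1\<close> such vertices and \<open>d - k\<close> vertices that miss one neighbour each;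
  the quotient matrix of this partition has rows \<open>(k, d - k)\<close> and \<open>(k + 1, d - k - 2)\<close> and
  characteristic polynomial \<open>X\<^sup>2 - (d - 2) X - (d + k)\<close>.  Its eigenvector for \<open>t\<close>,
  \<open>(d - k, t - k)\<close>, provides the two values of the test function.  Other distributions of the missing
  degrees do not decrease the quotient: only the total of the missing degrees enters, weighted by
  the square of the second value.
\<close>

lemma cluster_test_function:
  fixes adj :: "'a \<Rightarrow> 'a \<Rightarrow> bool" and C :: "'a set" and d k :: nat and t :: real
  assumes fin: "finite C" and ne: "C \<noteq> {}"
    and sym: "\<And>u v. adj u v \<Longrightarrow> adj v u" and irrefl: "\<And>v. \<not> adj v v"
    and k: "1 \<le> k" "k < d"
    and deg: "\<And>v. v \<in> C \<Longrightarrow> card {w\<in>C. adj v w} \<le> d"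
    and deficiency: "(\<Sum>v\<in>C. d - card {w\<in>C. adj v w}) \<le> d - k"
    and root: "t\<^sup>2 = (real d - 2) * t + real d + real k" and "t \<le> real d"
  obtains f :: "'a \<Rightarrow> real" where "\<exists>v\<in>C. f v \<noteq> 0" "\<And>v. v \<notin> C \<Longrightarrow> f v = 0"
    "t * (\<Sum>v\<in>C. (f v)\<^sup>2) \<le> (\<Sum>u\<in>C. \<Sum>v\<in>C. of_bool (adj u v) * f u * f v)"
proof -
  define deg_C where "deg_C v = card {w\<in>C. adj v w}" for v
  define m where "m = card C"
  have row: "(\<Sum>v\<in>C. of_bool (adj u v) * h v) = (\<Sum>v\<in>{w\<in>C. adj u w}. h v)"
    for u and h :: "'a \<Rightarrow> real"
    using fin by (intro sum.mono_neutral_cong_right) auto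
  have deg_le: "deg_C v \<le> d" if "v \<in> C" for v
    using deg[OF that] by (simp add: deg_C_def)
  have def_sum: "(\<Sum>v\<in>C. d - deg_C v) \<le> d - k"
    using deficiency by (simp add: deg_C_def)
  have m_pos: "m \<ge> 1"
    using fin ne by (simp add: m_def Suc_le_eq card_gt_0_iff)
  have m_gt: "m \<ge> d + 1"
  proof (rule ccontr)
    assume "\<not> m \<ge> d + 1"
    hence md: "m \<le> d" by simp
    have "d - m + 1 \<le> d - deg_C v" if "v \<in> C" for v
    proof -
      have "deg_C v \<le> card (C - {v})"
        unfolding deg_C_def using fin irrefl by (intro card_mono) auto
      also have "\<dots> = m - 1" using that fin by (simp add: m_def)
      finally show ?thesis using md m_pos by linarith
    qed
    hence "m * (d - m + 1) \<le> (\<Sum>v\<in>C. d - deg_C v)"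
      using sum_mono[of C "\<lambda>_. d - m + 1" "\<lambda>v. d - deg_C v"] by (simp add: m_def)
    moreover have "d \<le> m * (d - m + 1)"
    proof -
      obtain r where r: "d = m + r" using md le_Suc_ex by blast
      obtain p where p: "m = Suc p" using m_pos by (cases m) auto
      show ?thesis by (simp add: r p)
    qed
    ultimately show False using def_sum k by linarith
  qed
  show thesis
  proof (cases "m = d + 1")
    case False
    define f :: "'a \<Rightarrow> real" where "f v = of_bool (v \<in> C)" for v
    have quad: "(\<Sum>u\<in>C. \<Sum>v\<in>C. of_bool (adj u v) * f u * f v) = (\<Sum>u\<in>C. real (deg_C u))"
    proof (rule sum.cong[OF refl])
      fix u assume u: "u \<in> C"
      have "(\<Sum>v\<in>C. of_bool (adj u v) * f u * f v) = (\<Sum>v\<in>C. of_bool (adj u v) * 1)"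
        by (rule sum.cong) (auto simp: f_def u)
      thus "(\<Sum>v\<in>C. of_bool (adj u v) * f u * f v) = real (deg_C u)"
        unfolding row by (simp add: deg_C_def)
    qed
    have "real m * real d - (\<Sum>u\<in>C. real (deg_C u)) = real (\<Sum>v\<in>C. d - deg_C v)"
      using deg_le by (simp add: of_nat_diff sum_subtractf m_def)
    also have "\<dots> \<le> real d - real k"
      using def_sum k by (metis of_nat_diff of_nat_le_iff less_imp_le)
    \<comment> \<open>By the equation for \<open>t\<close>, \<open>d - t\<close> is a root of \<open>X\<^sup>2 - (d + 2) X + (d - k)\<close>.\<close>
    also have "\<dots> = (real d - t) * (real d + 2) - (real d - t)\<^sup>2"
      using root by (simp add: power2_eq_square algebra_simps)
    also have "\<dots> \<le> (real d - t) * (real d + 2)" by simp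
    also have "\<dots> \<le> (real d - t) * real m"
      using \<open>t \<le> real d\<close> False m_gt by (intro mult_left_mono) auto
    finally have "t * real m \<le> (\<Sum>u\<in>C. real (deg_C u))"
      by (simp add: algebra_simps)
    moreover have "(\<Sum>v\<in>C. (f v)\<^sup>2) = real m"
      by (simp add: f_def m_def)
    ultimately show thesis
      using ne by (intro that[of f]) (auto simp: quad, auto simp: f_def)
  next
    case True
    define Z where "Z = {v\<in>C. deg_C v = d}"
    have "card (C - Z) \<le> (\<Sum>v\<in>C - Z. d - deg_C v)"
    proof -
      have "(\<Sum>v\<in>C - Z. 1) \<le> (\<Sum>v\<in>C - Z. d - deg_C v)"
        by (rule sum_mono) (use deg_le in \<open>fastforce simp: Z_def\<close>)
      thus ?thesis by simp
    qed
    also have "\<dots> \<le> (\<Sum>v\<in>C. d - deg_C v)"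
      using fin by (intro sum_mono2) auto
    finally have "card (C - Z) \<le> d - k" using def_sum by simp
    moreover have "card C = card Z + card (C - Z)"
      using fin by (metis (no_types, lifting) Z_def card_Diff_subset card_mono finite_subset le_add_diff_inverse mem_Collect_eq subsetI)
    ultimately have "k + 1 \<le> card Z" using True k by (simp add: m_def)
    then obtain A where A: "A \<subseteq> Z" "card A = k + 1"
      using obtain_subset_with_card_n by metis
    have AC: "A \<subseteq> C" using A(1) by (auto simp: Z_def)
    have finA: "finite A" using AC fin finite_subset by blast
    define B where "B = C - A"
    have finB: "finite B" using fin by (simp add: B_def)
    have cardB: "card B = d - k"
      using card_Diff_subset[OF finA AC] True A(2) k by (simp add: B_def m_def)
    have full: "{w\<in>C. adj v w} = C - {v}" if "v \<in> A" for v
    proof (rule card_subset_eq)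
      show "card {w\<in>C. adj v w} = card (C - {v})"
        using that A(1) AC True fin by (auto simp: Z_def deg_C_def m_def)
    qed (use fin irrefl in auto)
    define a b where "a = real d - real k" and "b = t - real k"
    \<comment> \<open>The eigenvalue equations of the quotient matrix for \<open>(a, b)\<close>.\<close>
    have eigA: "real k * a + a * b = t * a"
      by (simp add: a_def b_def algebra_simps)
    have eigB: "(real k + 1) * a + (a - 2) * b = t * b"
      using root by (simp add: a_def b_def power2_eq_square algebra_simps)
    define f where "f v = (if v \<in> A then a else if v \<in> B then b else 0)" for v
    have split: "sum h C = sum h A + sum h B" for h :: "'a \<Rightarrow> real"
      unfolding B_def using sum.subset_diff[OF AC fin, of h] by simp
    have sumA: "(\<Sum>v\<in>A. f v) = (real k + 1) * a"
      using A(2) by (simp add: f_def algebra_simps)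
    have fB: "f v = b" if "v \<in> B" for v using that by (simp add: f_def B_def)
    have sumB: "(\<Sum>v\<in>B. f v) = a * b"
      using cardB k by (simp add: fB a_def of_nat_diff)
    have rowA: "(\<Sum>v\<in>C. of_bool (adj u v) * f v) = t * a" if "u \<in> A" for u
    proof -
      have "u \<in> C" "f u = a" using that AC by (auto simp: f_def)
      have "(\<Sum>v\<in>C. of_bool (adj u v) * f v) = sum f C - f u"
        unfolding row full[OF that] using fin \<open>u \<in> C\<close> by (simp add: sum_diff1)
      also have "\<dots> = t * a"
        unfolding split sumA sumB \<open>f u = a\<close> using eigA by (simp add: algebra_simps)
      finally show ?thesis .
    qed
    \<comment> \<open>A vertex of \<open>B\<close> that misses exactly one neighbour gives \<open>t b\<close>; the correction terms account for
        any other number of missing neighbours.\<close>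
    have rowB: "(\<Sum>v\<in>C. of_bool (adj u v) * f v) = t * b + b - real (d - deg_C u) * b" if "u \<in> B" for u
    proof -
      have "u \<in> C" using that by (simp add: B_def)
      have AN: "A \<subseteq> {w\<in>C. adj u w}"
      proof
        fix w assume w: "w \<in> A"
        have "u \<in> C - {w}" using that w by (auto simp: B_def)
        hence "adj w u" using full[OF w] by blast
        thus "w \<in> {w\<in>C. adj u w}" using sym w AC by blast
      qed
      have "(\<Sum>v\<in>C. of_bool (adj u v) * f v) = sum f A + sum f ({w\<in>C. adj u w} - A)"
        unfolding row using sum.subset_diff[OF AN, of f] fin by simp
      also have "sum f ({w\<in>C. adj u w} - A) = (\<Sum>v\<in>{w\<in>C. adj u w} - A. b)"
        by (rule sum.cong) (auto intro!: fB simp: B_def)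
      also have "\<dots> = (real (deg_C u) - (real k + 1)) * b"
      proof -
        have "card ({w\<in>C. adj u w} - A) = deg_C u - (k + 1)"
          using card_Diff_subset[OF finA AN] A(2) by (simp add: deg_C_def)
        moreover have "k + 1 \<le> deg_C u"
          using card_mono[OF _ AN] fin A(2) by (simp add: deg_C_def)
        ultimately show ?thesis by (simp add: of_nat_diff)
      qed
      also have "sum f A + (real (deg_C u) - (real k + 1)) * b
        = (real k + 1) * a + (a - 2) * b + b - real (d - deg_C u) * b"
        unfolding sumA using deg_le[OF \<open>u \<in> C\<close>] by (simp add: of_nat_diff a_def algebra_simps)
      also have "\<dots> = t * b + b - real (d - deg_C u) * b" using eigB by simp
      finally show ?thesis .
    qed
    have defB: "(\<Sum>u\<in>B. real (d - deg_C u)) \<le> a"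
    proof -
      have "(\<Sum>u\<in>B. d - deg_C u) \<le> (\<Sum>u\<in>C. d - deg_C u)"
        using fin by (intro sum_mono2) (auto simp: B_def)
      hence "(\<Sum>u\<in>B. d - deg_C u) \<le> d - k" using def_sum by simp
      hence "real (\<Sum>u\<in>B. d - deg_C u) \<le> real (d - k)" by (simp only: of_nat_le_iff)
      thus ?thesis using k by (simp add: a_def of_nat_diff)
    qed
    have norm: "(\<Sum>v\<in>C. (f v)\<^sup>2) = (real k + 1) * a\<^sup>2 + a * b\<^sup>2"
    proof -
      have "(\<Sum>v\<in>A. (f v)\<^sup>2) = (real k + 1) * a\<^sup>2"
        using A(2) by (simp add: f_def algebra_simps)
      moreover have "(\<Sum>v\<in>B. (f v)\<^sup>2) = a * b\<^sup>2"
        using cardB k by (simp add: fB a_def of_nat_diff)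
      ultimately show ?thesis by (simp add: split)
    qed
    have "t * ((real k + 1) * a\<^sup>2 + a * b\<^sup>2)
      = (real k + 1) * a * (t * a) + (a * (t * b\<^sup>2 + b\<^sup>2) - a * b\<^sup>2)"
      by (simp add: power2_eq_square algebra_simps)
    also have "\<dots> \<le> (real k + 1) * a * (t * a)
        + (a * (t * b\<^sup>2 + b\<^sup>2) - (\<Sum>u\<in>B. real (d - deg_C u)) * b\<^sup>2)"
      using mult_right_mono[OF defB, of "b\<^sup>2"] by simp
    also have "\<dots> = (\<Sum>u\<in>A. f u * (t * a)) + (\<Sum>u\<in>B. b * (t * b + b - real (d - deg_C u) * b))"
    proof -
      have "(\<Sum>u\<in>A. f u * (t * a)) = (real k + 1) * a * (t * a)"
        unfolding sum_distrib_right[symmetric] sumA ..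
      moreover have "(\<Sum>u\<in>B. b * (t * b + b - real (d - deg_C u) * b))
        = (\<Sum>u\<in>B. (t * b\<^sup>2 + b\<^sup>2) - real (d - deg_C u) * b\<^sup>2)"
        by (rule sum.cong) (auto simp: power2_eq_square algebra_simps)
      moreover have "\<dots> = a * (t * b\<^sup>2 + b\<^sup>2) - (\<Sum>u\<in>B. real (d - deg_C u)) * b\<^sup>2"
        unfolding sum_subtractf sum_distrib_right using cardB k by (simp add: a_def of_nat_diff)
      ultimately show ?thesis by simp
    qed
    also have "\<dots> = (\<Sum>u\<in>C. f u * (\<Sum>v\<in>C. of_bool (adj u v) * f v))"
      unfolding split[of "\<lambda>u. f u * (\<Sum>v\<in>C. of_bool (adj u v) * f v)"]
      by (intro arg_cong2[of _ _ _ _ "(+)"] sum.cong refl) (simp_all only: rowA rowB fB)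
    also have "\<dots> = (\<Sum>u\<in>C. \<Sum>v\<in>C. of_bool (adj u v) * f u * f v)"
      unfolding sum_distrib_left by (intro sum.cong refl) (simp add: mult_ac)
    finally have form: "t * (\<Sum>v\<in>C. (f v)\<^sup>2) \<le> (\<Sum>u\<in>C. \<Sum>v\<in>C. of_bool (adj u v) * f u * f v)"
      unfolding norm .
    obtain z where "z \<in> A" using A(2) by fastforce
    hence "z \<in> C" "f z \<noteq> 0" using AC k by (auto simp: f_def a_def)
    moreover have "f v = 0" if "v \<notin> C" for v using that AC by (auto simp: f_def B_def)
    ultimately show thesis using form by (intro that[of f]) auto
  qed
qed

section \<open>Edge cuts and components\<close>

lemma handshake_even:
  assumes "finite C" and sym: "\<And>u v. adj u v \<Longrightarrow> adj v u" and irrefl: "\<And>v. \<not> adj v v"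
  shows "even (\<Sum>v\<in>C. card {w\<in>C. adj v w})"
  using assms(1)
proof (induction C)
  case (insert x C)
  \<comment> \<open>Every neighbour of the new vertex is counted twice: once for the vertex itself, once for the neighbour.\<close>
  have "card {w \<in> insert x C. adj v w} = card {w\<in>C. adj v w} + of_bool (adj v x)" if "v \<in> C" for v
  proof -
    have "{w \<in> insert x C. adj v w} = (if adj v x then insert x {w\<in>C. adj v w} else {w\<in>C. adj v w})"
      by auto
    thus ?thesis using insert.hyps by simp
  qed
  hence "(\<Sum>v\<in>C. card {w \<in> insert x C. adj v w})
      = (\<Sum>v\<in>C. card {w\<in>C. adj v w}) + (\<Sum>v\<in>C. of_bool (adj v x))"
    by (simp add: sum.distrib)
  also have "(\<Sum>v\<in>C. of_bool (adj v x)) = card {v\<in>C. adj x v}"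
    using insert.hyps(1) sym by (simp add: Int_def) (metis (no_types, lifting))
  finally have "(\<Sum>v\<in>insert x C. card {w \<in> insert x C. adj v w})
      = card {w \<in> insert x C. adj x w} + ((\<Sum>v\<in>C. card {w\<in>C. adj v w}) + card {v\<in>C. adj x v})"
    using insert.hyps by simp
  moreover have "{w \<in> insert x C. adj x w} = {w\<in>C. adj x w}"
    using irrefl by auto
  ultimately show ?case using insert.IH by simp
qed simp

lemma connected_subset_closed:
  assumes conn: "Digraph_Component.connected H" and u: "u \<in> C" "u \<in> verts H"
    and closed: "\<And>x y. x \<in> C \<Longrightarrow> x \<rightarrow>\<^bsub>H\<^esub> y \<or> y \<rightarrow>\<^bsub>H\<^esub> x \<Longrightarrow> y \<in> C"
  shows "verts H \<subseteq> C"
proof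
  fix v assume "v \<in> verts H"
  hence "(u, v) \<in> rtrancl_on (verts H) ((arcs_ends H)\<^sup>s)"
    using conn u by (simp add: connected_conv)
  thus "v \<in> C"
    by (induction rule: rtrancl_on_induct) (use u closed in \<open>auto simp: symcl_def\<close>)
qed

lemma edge_connectivity_le_boundary:
  assumes G: "graph G" and C: "C \<subseteq> verts G" "C \<noteq> {}" "C \<noteq> verts G"
  shows "edge_connectivity G \<le> (\<Sum>v\<in>C. card {w \<in> verts G - C. v \<rightarrow>\<^bsub>G\<^esub> w})"
proof -
  interpret graph G by (rule G)
  define B where "B = (SIGMA v:C. {w \<in> verts G - C. v \<rightarrow>\<^bsub>G\<^esub> w})"
  define F where "F = (\<lambda>(v, w). {v, w}) ` B"
  have finC: "finite C" using C(1) finite_subset finite_verts by blast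
  have "finite B"
    unfolding B_def by (rule finite_SigmaI[OF finC]) simp
  have "F \<subseteq> graph_edges G"
    unfolding F_def B_def graph_edges_def by (auto simp: arcs_ends_conv)
  moreover have "\<not> Digraph_Component.connected (del_edges G F)"
  proof
    assume conn: "Digraph_Component.connected (del_edges G F)"
    obtain u where u: "u \<in> C" using C(2) by blast
    have "verts (del_edges G F) \<subseteq> C"
    proof (rule connected_subset_closed[OF conn u])
      show "u \<in> verts (del_edges G F)" using u C(1) by (auto simp: del_edges_def)
      fix x y assume x: "x \<in> C" and xy: "x \<rightarrow>\<^bsub>del_edges G F\<^esub> y \<or> y \<rightarrow>\<^bsub>del_edges G F\<^esub> x"
      have "x \<rightarrow>\<^bsub>G\<^esub> y \<and> {x, y} \<notin> F"
        using xy graph_symmetric[of y x]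
        by (auto simp: del_edges_def arcs_ends_conv insert_commute)
      thus "y \<in> C"
        using x adj_in_verts(2)[of x y] by (force simp: F_def B_def)
    qed
    thus False using C by (auto simp: del_edges_def)
  qed
  ultimately have "edge_connectivity G \<le> card F"
    unfolding edge_connectivity_def by (intro wellorder_Inf_le1) blast
  also have "\<dots> \<le> card B"
    unfolding F_def by (rule card_image_le[OF \<open>finite B\<close>])
  also have "\<dots> = (\<Sum>v\<in>C. card {w \<in> verts G - C. v \<rightarrow>\<^bsub>G\<^esub> w})"
    unfolding B_def using finC by (simp add: card_SigmaI)
  finally show ?thesis .
qed

lemma (in nomulti_digraph) out_degree_eq_card_successors:
  "out_degree G v = card {w. v \<rightarrow>\<^bsub>G\<^esub> w}"
proof -
  have "inj_on (head G) (out_arcs G v)"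
    by (rule inj_onI) (auto intro: no_multi_arcs simp: arc_to_ends_def)
  moreover have "head G ` out_arcs G v = {w. v \<rightarrow>\<^bsub>G\<^esub> w}"
    by (auto simp: arcs_ends_conv)
  ultimately show ?thesis
    unfolding out_degree_def using card_image by metis
qed

lemma strongly_connected_imp_connected:
  assumes "strongly_connected H"
  shows "Digraph_Component.connected H"
proof -
  have "arcs_ends H \<subseteq> (arcs_ends H)\<^sup>s" by (auto simp: symcl_def)
  note mono = rtrancl_on_mono[OF this subset_refl]
  show ?thesis
    using assms unfolding connected_conv strongly_connected_def reachable_def
    by (auto intro: mono)
qed

text \<open>
  A maximal connected subgraph is induced, because additional arcs on the same vertices keep it
  connected; so it inherits symmetry, and for symmetric digraphs connected means strongly
  connected.  This makes the theory of strongly connected components available.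
\<close>

lemma (in sym_digraph) graph_components_subset_sccs: "graph_components G \<subseteq> sccs"
proof
  fix K assume "K \<in> graph_components G"
  hence K: "max_subgraph Digraph_Component.connected K"
    by (simp add: graph_components_def)
  have "arc_mono (Digraph_Component.connected :: ('a, 'b) pre_digraph \<Rightarrow> bool)"
    unfolding arc_mono_def
  proof (intro allI impI, elim conjE)
    fix H1 H2 :: "('a, 'b) pre_digraph"
    assume "Digraph_Component.connected H1" and sub: "subgraph H1 H2" and "verts H1 = verts H2"
    moreover from sub have "wf_digraph H2" by (rule subgraphE)
    ultimately show "Digraph_Component.connected H2"
      using wf_digraph.connected_spanning_imp_connected[of H2 H1] by (simp add: spanning_def)
  qed
  hence ind: "induced_subgraph K G"
    using induced_subgraphI_arc_mono[OF K] by blast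
  interpret K: wf_digraph K using ind by (rule wf_digraphI_induced)
  have compat: "compatible G K" and K_arcs: "arcs K = {e \<in> arcs G. tail G e \<in> verts K \<and> head G e \<in> verts K}"
    using ind unfolding induced_subgraph_def subgraph_def by blast+
  note K_eq = compatible_tail[OF compat, symmetric] compatible_head[OF compat, symmetric] K_arcs
  have "symmetric K"
    unfolding symmetric_conv
  proof
    fix e1 assume e1: "e1 \<in> arcs K"
    hence "e1 \<in> arcs G" by (simp add: K_eq(3))
    then obtain e2 where "e2 \<in> arcs G" "tail G e1 = head G e2" "head G e1 = tail G e2"
      using sym_arcs unfolding symmetric_conv by blast
    thus "\<exists>e2\<in>arcs K. tail K e1 = head K e2 \<and> head K e1 = tail K e2"
      using e1 by (intro bexI[of _ e2]) (simp_all add: K_eq)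
  qed
  hence "strongly_connected K"
    using K.symmetric_connected_imp_strongly_connected max_subgraph_prop[OF K] by blast
  thus "K \<in> sccs"
    unfolding sccs_altdef2 using max_subgraph_mp[OF K strongly_connected_imp_connected] by simp
qed

lemma component_vertex_sets:
  assumes G: "graph G" and "S \<subseteq> verts G"
  obtains P where "finite P" "card (graph_components (G \<restriction> (verts G - S))) \<le> card P"
    "\<And>C. C \<in> P \<Longrightarrow> C \<noteq> {} \<and> C \<subseteq> verts G - S" "disjoint P"
    "\<And>C u v. C \<in> P \<Longrightarrow> u \<in> C \<Longrightarrow> u \<rightarrow>\<^bsub>G\<^esub> v \<Longrightarrow> v \<in> C \<union> S"
proof -
  interpret graph G by (rule G)
  define H where "H = G \<restriction> (verts G - S)"
  have "wf_digraph H" unfolding H_def by (rule wellformed_induce_subgraph)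
  moreover have "\<forall>e1\<in>arcs G. \<exists>e2\<in>arcs G. tail G e1 = head G e2 \<and> head G e1 = tail G e2"
    using sym_arcs by (simp add: symmetric_conv)
  hence "symmetric H"
    unfolding symmetric_conv H_def by simp metis
  ultimately interpret H: sym_digraph H
    by (simp add: sym_digraph_def sym_digraph_axioms_def)
  interpret H: fin_digraph H
    by (rule H.fin_digraphI) (auto simp: H_def)
  have "finite H.sccs_verts" by (rule H.finite_sccs_verts)
  hence fin: "finite H.sccs" by (simp add: H.sccs_conv_sccs_verts)
  show thesis
  proof (rule that[of H.sccs_verts])
    show "finite H.sccs_verts" by fact
    show "card (graph_components (G \<restriction> (verts G - S))) \<le> card H.sccs_verts"
      unfolding H.card_sccs_verts H_def[symmetric]
      by (rule card_mono[OF fin H.graph_components_subset_sccs])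
    show "C \<noteq> {} \<and> C \<subseteq> verts G - S" if "C \<in> H.sccs_verts" for C
      using that H.sccs_verts_subsets[OF that] unfolding H.sccs_verts_def by (simp add: H_def)
    show "disjoint H.sccs_verts"
      using H.sccs_verts_disjoint by (auto simp: disjoint_def)
    fix C u v assume C: "C \<in> H.sccs_verts" and u: "u \<in> C" and uv: "u \<rightarrow>\<^bsub>G\<^esub> v"
    show "v \<in> C \<union> S"
    proof (rule ccontr)
      assume v: "v \<notin> C \<union> S"
      have "u \<in> verts G - S" using H.sccs_verts_subsets[OF C] u by (auto simp: H_def)
      hence "u \<rightarrow>\<^bsub>H\<^esub> v"
        using v uv adj_in_verts(2)[OF uv] unfolding H_def by (auto simp: arcs_ends_conv)
      hence "u \<rightarrow>\<^sup>*\<^bsub>H\<^esub> v" "v \<rightarrow>\<^sup>*\<^bsub>H\<^esub> u"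
        using H.symmetric_reachable' by auto
      thus False using C u v unfolding H.sccs_verts_def by blast
    qed
  qed
qed

section \<open>Toughness of regular graphs\<close>

text \<open>
  The inequality says that the Rayleigh quotient of \<open>f\<close> for the adjacency matrix is at least \<open>t\<close>.
\<close>

definition test_function :: "('a, 'b) pre_digraph \<Rightarrow> real \<Rightarrow> 'a set \<Rightarrow> ('a \<Rightarrow> real) \<Rightarrow> bool" where
  "test_function G t C f \<longleftrightarrow>
     (\<exists>v\<in>verts G. f v \<noteq> 0) \<and> (\<forall>v. v \<notin> C \<longrightarrow> f v = 0) \<and>
     t * (\<Sum>v\<in>verts G. (f v)\<^sup>2)
       \<le> (\<Sum>u\<in>verts G. \<Sum>v\<in>verts G. of_bool (u \<rightarrow>\<^bsub>G\<^esub> v) * f u * f v)"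

text \<open>
  Of the \<open>d\<close> neighbours of a vertex, those missing inside \<open>C\<close> are exactly those outside, so the
  boundary of \<open>C\<close> is the total degree deficiency in \<open>C\<close>.  The parity of \<open>d\<close> enters here: for
  even \<open>d\<close> the boundary is even and smaller than \<open>d\<close>, hence at most \<open>d - 2\<close>.
\<close>

lemma sparse_boundary_test_function:
  fixes G :: "('a, 'b) pre_digraph" and d :: nat
  assumes G: "graph G" and reg: "regular_graph G d" and d: "d \<ge> 3"
    and C: "C \<subseteq> verts G" "C \<noteq> {}"
    and boundary: "(\<Sum>v\<in>C. card {w \<in> verts G - C. v \<rightarrow>\<^bsub>G\<^esub> w}) < d"
    and t: "t = (if even d then (real d - 2 + sqrt ((real d)\<^sup>2 + 12)) / 2
            else (real d - 2 + sqrt ((real d)\<^sup>2 + 8)) / 2)"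
  shows "\<exists>f. test_function G t C f"
proof -
  interpret graph G by (rule G)
  have finC: "finite C" using C(1) finite_subset finite_verts by blast
  define k :: nat where "k = (if even d then 2 else 1)"
  define s where "s = sqrt ((real d)\<^sup>2 + 4 + 4 * real k)"
  have k: "1 \<le> k" "k < d" using d by (auto simp: k_def)
  have t_s: "t = (real d - 2 + s) / 2"
    by (simp add: t s_def k_def)
  have s2: "s\<^sup>2 = (real d)\<^sup>2 + 4 + 4 * real k" by (simp add: s_def)
  have root: "t\<^sup>2 = (real d - 2) * t + real d + real k"
  proof -
    have "4 * t\<^sup>2 = (real d - 2)\<^sup>2 + 2 * (real d - 2) * s + s\<^sup>2"
      by (simp add: t_s power2_eq_square field_simps)
    thus ?thesis unfolding s2 by (simp add: t_s power2_eq_square field_simps)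
  qed
  have "t \<le> real d"
  proof -
    have "s\<^sup>2 \<le> (real d + 2)\<^sup>2"
      unfolding s2 using k by (simp add: power2_eq_square algebra_simps)
    hence "s \<le> real d + 2" by (rule power2_le_imp_le) simp
    thus ?thesis by (simp add: t_s)
  qed
  have deg: "card {w\<in>C. v \<rightarrow>\<^bsub>G\<^esub> w} + card {w \<in> verts G - C. v \<rightarrow>\<^bsub>G\<^esub> w} = d" if "v \<in> C" for v
  proof -
    have split: "{w. v \<rightarrow>\<^bsub>G\<^esub> w} = {w\<in>C. v \<rightarrow>\<^bsub>G\<^esub> w} \<union> {w \<in> verts G - C. v \<rightarrow>\<^bsub>G\<^esub> w}"
      using adj_in_verts(2) by auto
    have "card {w. v \<rightarrow>\<^bsub>G\<^esub> w} = card {w\<in>C. v \<rightarrow>\<^bsub>G\<^esub> w} + card {w \<in> verts G - C. v \<rightarrow>\<^bsub>G\<^esub> w}"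
      unfolding split by (rule card_Un_disjoint) (use finC in auto)
    moreover have "card {w. v \<rightarrow>\<^bsub>G\<^esub> w} = d"
      using reg that C(1) out_degree_eq_card_successors[of v] by (auto simp: regular_graph_def)
    ultimately show ?thesis by simp
  qed
  have outside: "d - card {w\<in>C. v \<rightarrow>\<^bsub>G\<^esub> w} = card {w \<in> verts G - C. v \<rightarrow>\<^bsub>G\<^esub> w}" if "v \<in> C" for v
    using deg[OF that] by linarith
  have boundary_le: "(\<Sum>v\<in>C. card {w \<in> verts G - C. v \<rightarrow>\<^bsub>G\<^esub> w}) \<le> d - k"
  proof (cases "even d")
    case True
    define x where "x = (\<Sum>v\<in>C. card {w\<in>C. v \<rightarrow>\<^bsub>G\<^esub> w})"
    define y where "y = (\<Sum>v\<in>C. card {w \<in> verts G - C. v \<rightarrow>\<^bsub>G\<^esub> w})"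
    have "x + y = (\<Sum>v\<in>C. d)"
      unfolding x_def y_def sum.distrib[symmetric] by (rule sum.cong[OF refl deg])
    hence "even (x + y)" using True by simp
    moreover have "even x"
      unfolding x_def by (rule handshake_even[OF finC]) (blast intro: graph_symmetric dest: adj_not_same)+
    ultimately have "even y" by simp
    moreover have "y < d" using boundary by (simp only: y_def)
    ultimately have "y \<le> d - 2" using True by (elim evenE) simp
    thus ?thesis using True by (simp only: y_def k_def if_True)
  next
    case False
    thus ?thesis using boundary by (simp only: k_def if_False)
  qed
  obtain f :: "'a \<Rightarrow> real" where f: "\<exists>v\<in>C. f v \<noteq> 0" "\<And>v. v \<notin> C \<Longrightarrow> f v = 0"
    "t * (\<Sum>v\<in>C. (f v)\<^sup>2) \<le> (\<Sum>u\<in>C. \<Sum>v\<in>C. of_bool (u \<rightarrow>\<^bsub>G\<^esub> v) * f u * f v)"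
  proof (rule cluster_test_function[of C "\<lambda>u v. u \<rightarrow>\<^bsub>G\<^esub> v" k d t])
    show "(\<Sum>v\<in>C. d - card {w\<in>C. v \<rightarrow>\<^bsub>G\<^esub> w}) \<le> d - k"
      using boundary_le by (simp add: outside)
    show "card {w\<in>C. v \<rightarrow>\<^bsub>G\<^esub> w} \<le> d" if "v \<in> C" for v
      using deg[OF that] by linarith
    show "v \<rightarrow>\<^bsub>G\<^esub> u" if "u \<rightarrow>\<^bsub>G\<^esub> v" for u v
      using that by (rule graph_symmetric)
    show "\<not> v \<rightarrow>\<^bsub>G\<^esub> v" for v
      using adj_not_same by blast
  qed (use finC C k root \<open>t \<le> real d\<close> in blast)+
  have restrict: "(\<Sum>v\<in>verts G. h v) = (\<Sum>v\<in>C. h v)" if "\<And>v. v \<notin> C \<Longrightarrow> h v = 0" for h :: "'a \<Rightarrow> real"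
    using C(1) that by (intro sum.mono_neutral_right) auto
  have "(\<Sum>v\<in>verts G. (f v)\<^sup>2) = (\<Sum>v\<in>C. (f v)\<^sup>2)"
    by (rule restrict) (simp add: f(2))
  moreover have "(\<Sum>u\<in>verts G. \<Sum>v\<in>verts G. of_bool (u \<rightarrow>\<^bsub>G\<^esub> v) * f u * f v)
      = (\<Sum>u\<in>C. \<Sum>v\<in>C. of_bool (u \<rightarrow>\<^bsub>G\<^esub> v) * f u * f v)"
    by (subst restrict, simp add: f(2), intro sum.cong refl restrict, simp add: f(2))
  ultimately have "test_function G t C f"
    unfolding test_function_def using f C(1) by auto
  thus ?thesis by blast
qed

theorem theorem1p10:
  fixes G :: "('a, 'b) pre_digraph" and d \<kappa> :: nat
  assumes "Digraph.graph G"
    and "Digraph_Component.connected G"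
    and "regular_graph G d"
    and "d \<ge> 3"
    and "\<kappa> = edge_connectivity G"
    and "\<kappa> = d \<or>
         \<kappa> < d \<and>
         eigenvalue_nth G (nat \<lceil>real d / (real d - real \<kappa>)\<rceil>) <
           (if even d then (real d - 2 + sqrt ((real d)\<^sup>2 + 12)) / 2
            else (real d - 2 + sqrt ((real d)\<^sup>2 + 8)) / 2)"
  shows "toughness G \<ge> 1"
proof -
  interpret graph G by (rule assms(1))
  have main: "card (graph_components (G \<restriction> (verts G - S))) \<le> card S"
    if S: "S \<subset> verts G" and c: "card (graph_components (G \<restriction> (verts G - S))) > 1" for S
  proof (rule ccontr)
    assume less: "\<not> card (graph_components (G \<restriction> (verts G - S))) \<le> card S"
    have "S \<subseteq> verts G" using S by auto
    obtain P where P: "finite P"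
      "card (graph_components (G \<restriction> (verts G - S))) \<le> card P"
      "\<And>C. C \<in> P \<Longrightarrow> C \<noteq> {} \<and> C \<subseteq> verts G - S" "disjoint P"
      "\<And>C u v. C \<in> P \<Longrightarrow> u \<in> C \<Longrightarrow> u \<rightarrow>\<^bsub>G\<^esub> v \<Longrightarrow> v \<in> C \<union> S"
      by (rule component_vertex_sets[OF assms(1) \<open>S \<subseteq> verts G\<close>], rule that, assumption+)
    have cardP: "card S < card P" "card P > 1" using less c P(2) by auto
    have finS: "finite S" using S finite_subset finite_verts by blast
    have finC: "finite C" if "C \<in> P" for C
      using P(3)[OF that] finite_subset[of C "verts G"] by auto
    \<comment> \<open>An empty \<open>S\<close> would leave the connected graph \<open>G\<close> intact, with a single component.\<close>
    have "S \<noteq> {}"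
    proof
      assume "S = {}"
      have all: "C = verts G" if "C \<in> P" for C
      proof -
        obtain u where "u \<in> C" using P(3)[OF \<open>C \<in> P\<close>] by blast
        have "verts G \<subseteq> C"
        proof (rule connected_subset_closed[OF assms(2) \<open>u \<in> C\<close>])
          show "u \<in> verts G" using P(3)[OF \<open>C \<in> P\<close>] \<open>u \<in> C\<close> by blast
          show "y \<in> C" if "x \<in> C" "x \<rightarrow>\<^bsub>G\<^esub> y \<or> y \<rightarrow>\<^bsub>G\<^esub> x" for x y
            using that P(5)[OF \<open>C \<in> P\<close>, of x y] \<open>S = {}\<close> graph_symmetric[of y x] by blast
        qed
        thus ?thesis using P(3)[OF \<open>C \<in> P\<close>] by blast
      qed
      hence "P \<subseteq> {verts G}" by blast
      from card_mono[OF _ this] cardP(2) show False by simp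
    qed
    define e where "e C = (\<Sum>v\<in>C. card {w \<in> verts G - C. v \<rightarrow>\<^bsub>G\<^esub> w})" for C
    have e_S: "e C = (\<Sum>v\<in>C. card {w\<in>S. v \<rightarrow>\<^bsub>G\<^esub> w})" if "C \<in> P" for C
    proof -
      have "{w \<in> verts G - C. v \<rightarrow>\<^bsub>G\<^esub> w} = {w\<in>S. v \<rightarrow>\<^bsub>G\<^esub> w}" if "v \<in> C" for v
        using P(3)[OF \<open>C \<in> P\<close>] P(5)[OF \<open>C \<in> P\<close> that] S by auto
      thus ?thesis by (simp add: e_def)
    qed
    have conn_le: "\<kappa> \<le> e C" if "C \<in> P" for C
      unfolding e_def assms(5)
      by (rule edge_connectivity_le_boundary[OF assms(1)]) (use P(3)[OF that] S \<open>S \<noteq> {}\<close> in auto)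
    \<comment> \<open>Double counting: every vertex of \<open>S\<close> has only \<open>d\<close> neighbours.\<close>
    have sum_e: "(\<Sum>C\<in>P. e C) \<le> card S * d"
    proof -
      have "(\<Sum>C\<in>P. e C) = (\<Sum>v\<in>\<Union>P. card {w\<in>S. v \<rightarrow>\<^bsub>G\<^esub> w})"
        using P(4) finC by (subst sum.Union_disjoint) (auto simp: e_S disjoint_def)
      also have "\<dots> = (\<Sum>v\<in>\<Union>P. \<Sum>w\<in>S. of_bool (v \<rightarrow>\<^bsub>G\<^esub> w))"
        using finS by (simp add: Int_def)
      also have "\<dots> = (\<Sum>w\<in>S. \<Sum>v\<in>\<Union>P. of_bool (v \<rightarrow>\<^bsub>G\<^esub> w))"
        by (rule sum.swap)
      also have "\<dots> \<le> (\<Sum>w\<in>S. d)"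
      proof (rule sum_mono)
        fix w assume w: "w \<in> S"
        have "(\<Sum>v\<in>\<Union>P. of_bool (v \<rightarrow>\<^bsub>G\<^esub> w)) = card {v\<in>\<Union>P. v \<rightarrow>\<^bsub>G\<^esub> w}"
          using P(1) finC by (simp add: Int_def)
        also have "\<dots> \<le> card {v. w \<rightarrow>\<^bsub>G\<^esub> v}"
        proof (rule card_mono)
          show "finite {v. w \<rightarrow>\<^bsub>G\<^esub> v}"
            by (rule finite_subset[of _ "verts G"]) (use adj_in_verts in auto)
        qed (blast intro: graph_symmetric)
        also have "\<dots> = d"
          using assms(3) w S out_degree_eq_card_successors[of w] by (auto simp: regular_graph_def)
        finally show "(\<Sum>v\<in>\<Union>P. of_bool (v \<rightarrow>\<^bsub>G\<^esub> w)) \<le> d" .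
      qed
      finally show ?thesis by simp
    qed
    \<comment> \<open>The components in \<open>B\<close> carry the test functions; they are numerous since all others send at least \<open>d\<close> edges to \<open>S\<close>.\<close>
    define B where "B = {C\<in>P. e C < d}"
    have "B \<subseteq> P" and finB: "finite B" using P(1) by (auto simp: B_def)
    have "card B * \<kappa> + (card P - card B) * d \<le> (\<Sum>C\<in>P. e C)"
    proof -
      have "card B * \<kappa> \<le> (\<Sum>C\<in>B. e C)"
        using sum_mono[of B "\<lambda>_. \<kappa>" e] conn_le \<open>B \<subseteq> P\<close> by auto
      moreover have "(card P - card B) * d \<le> (\<Sum>C\<in>P - B. e C)"
        using sum_mono[of "P - B" "\<lambda>_. d" e] card_Diff_subset[OF finB \<open>B \<subseteq> P\<close>]
        by (auto simp: B_def not_less)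
      ultimately show ?thesis
        using sum.subset_diff[OF \<open>B \<subseteq> P\<close> P(1), of e] by linarith
    qed
    hence "real (card B * \<kappa> + (card P - card B) * d) \<le> real (card S * d)"
      using sum_e by linarith
    hence "real (card B) * real \<kappa> + (real (card P) - real (card B)) * real d \<le> real (card S) * real d"
      using card_mono[OF P(1) \<open>B \<subseteq> P\<close>] by (simp add: of_nat_diff)
    moreover have "(real (card S) + 1) * real d \<le> real (card P) * real d"
      using cardP(1) by (intro mult_right_mono) auto
    ultimately have count: "real d \<le> real (card B) * (real d - real \<kappa>)"
      by (simp add: algebra_simps)
    with assms(4) have "\<kappa> \<noteq> d" by auto
    with assms(6) have \<kappa>: "\<kappa> < d" and eig: "eigenvalue_nth G (nat \<lceil>real d / (real d - real \<kappa>)\<rceil>) <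
           (if even d then (real d - 2 + sqrt ((real d)\<^sup>2 + 12)) / 2
            else (real d - 2 + sqrt ((real d)\<^sup>2 + 8)) / 2)"
      by auto
    define q where "q = nat \<lceil>real d / (real d - real \<kappa>)\<rceil>"
    define t where "t = (if even d then (real d - 2 + sqrt ((real d)\<^sup>2 + 12)) / 2
            else (real d - 2 + sqrt ((real d)\<^sup>2 + 8)) / 2)"
    have "real d / (real d - real \<kappa>) \<le> real (card B)"
      using count \<kappa> by (simp add: pos_divide_le_eq)
    hence q_le: "q \<le> card B"
      unfolding q_def by (simp add: nat_le_iff ceiling_le_iff)
    have "0 < real d / (real d - real \<kappa>)" using \<kappa> assms(4) by simp
    hence q_pos: "1 \<le> q" unfolding q_def by linarith
    obtain g where g: "bij_betw g {0..<card B} B"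
      using ex_bij_betw_nat_finite[OF finB] by blast
    have gB: "g j \<in> B" if "j < q" for j
      using g that q_le by (auto simp: bij_betw_def)
    have g_neq: "g i \<noteq> g j" if "i < q" "j < q" "i \<noteq> j" for i j
      using g that q_le by (auto simp: bij_betw_def inj_on_def)
    have "\<exists>f. test_function G t C f" if "C \<in> B" for C
    proof -
      have "C \<in> P" "e C < d" using that by (auto simp: B_def)
      thus ?thesis
        using P(3)[OF \<open>C \<in> P\<close>]
        by (intro sparse_boundary_test_function[OF assms(1,3,4) _ _ _ t_def]) (auto simp: e_def)
    qed
    then obtain F where "\<And>C. C \<in> B \<Longrightarrow> test_function G t C (F C)"
      by metis
    hence F: "\<exists>v\<in>verts G. F C v \<noteq> 0" "v \<notin> C \<Longrightarrow> F C v = 0"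
      "t * (\<Sum>v\<in>verts G. (F C v)\<^sup>2)
        \<le> (\<Sum>u\<in>verts G. \<Sum>v\<in>verts G. of_bool (u \<rightarrow>\<^bsub>G\<^esub> v) * F C u * F C v)"
      if "C \<in> B" for C v
      using that unfolding test_function_def by blast+
    have apart: "g i \<inter> g j = {}" if "i < q" "j < q" "i \<noteq> j" for i j
      using P(4) gB[OF that(1)] gB[OF that(2)] g_neq[OF that] \<open>B \<subseteq> P\<close> by (auto simp: disjoint_def)
    have "t \<le> eigenvalue_nth G q"
    proof (rule eigenvalue_nth_ge_of_decoupled_functions[OF assms(1) q_pos, of "\<lambda>j. F (g j)"])
      fix i j u v assume ij: "i < q" "j < q" "i \<noteq> j"
      show "F (g i) u = 0 \<or> F (g j) u = 0"
        using apart[OF ij] F(2)[OF gB[OF ij(1)], of u] F(2)[OF gB[OF ij(2)], of u] by blast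
      assume uv: "u \<rightarrow>\<^bsub>G\<^esub> v"
      show "F (g i) u = 0 \<or> F (g j) v = 0"
      proof (rule ccontr)
        assume "\<not> ?thesis"
        hence "u \<in> g i" "v \<in> g j"
          using F(2)[OF gB[OF ij(1)], of u] F(2)[OF gB[OF ij(2)], of v] by blast+
        moreover have "g i \<in> P" "g j \<in> P" using gB ij \<open>B \<subseteq> P\<close> by auto
        ultimately show False using P(5)[of "g i" u v] P(3)[of "g j"] uv apart[OF ij] by blast
      qed
    qed (rule F[OF gB], assumption)+
    with eig show False unfolding q_def t_def by linarith
  qed
  show ?thesis
    unfolding toughness_def
  proof (rule INF_greatest)
    fix S assume "S \<in> {S. S \<subset> verts G \<and> card (graph_components (G \<restriction> (verts G - S))) > 1}"
    hence "card (graph_components (G \<restriction> (verts G - S))) \<le> card S"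
      "card (graph_components (G \<restriction> (verts G - S))) > 1" using main by auto
    thus "1 \<le> ereal (real (card S) / real (card (graph_components (G \<restriction> (verts G - S)))))"
      by (simp add: one_ereal_def le_divide_eq)
  qed
qed

end
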